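(* Let $k$ be a field of characteristic zero, let $F\in k[x_1,\ldots,x_n]$ be a nonzero homogeneous polynomial of degree $D\ge 1$, and let $A=Q/\mathrm{Ann}_Q F=\bigoplus_{d=0}^D A_d$ with $Q=k[X_1,\ldots,X_n]$ acting on $k[x_1,\ldots,x_n]$ by $X_i=\partial/\partial x_i$. (1) For each $d=1,\ldots,[D/2]$ let $\mathbf{B}_d$ be a $k$-linear basis of $A_d$. Then $A$ has the strong Lefschetz property if and only if all the higher Hessians $\mathrm{Hess}^{(d)}_{\mathbf{B}_d}F$, $d=1,\ldots,[D/2]$, are nonzero polynomials. (2) Assume that the socle degree $D$ of $A$ is less than $5$. Let $\mathrm{Hess}\,F=\mathrm{Hess}^{(1)}_{\mathbf{B}_1}F$ be the first Hessian of $F$ with respect to a $k$-linear basis $\mathbf{B}_1$ of $A_1$. Then an element $L=a_1X_1+\cdots+a_nX_n\in A_1$ ($a_i\in k$) is a strong Lefschetz element of $A$ if and only if $$F(a_1,\ldots,a_n)\neq 0\quad\text{and}\quad (\mathrm{Hess}\,F)(a_1,\ldots,a_n)\neq 0.$$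
   Context: $R=k[x_1,\ldots,x_n]$ is regarded as a module over $Q=k[X_1,\ldots,X_n]$ by letting $X_i$ act as $\partial/\partial x_i$. For $F\in R$, $\mathrm{Ann}_Q F=\{a(X_1,\ldots,X_n)\in Q \mid a(\partial_1,\ldots,\partial_n)F=0\}$. If $F$ is nonzero and homogeneous of degree $D$, this ideal is homogeneous and $A=Q/\mathrm{Ann}_Q F=\bigoplus_{d=0}^D A_d$ is a graded Artinian Gorenstein algebra (standard grading) of socle degree $D$. An element $L\in A_1$ is a strong Lefschetz element of $A$ (in the narrow sense) if the multiplication map $\times L^{D-2i}:A_i\to A_{D-i}$ is bijective for all $i=0,\ldots,[D/2]$, where $[\cdot]$ is the integer part. $A$ has the strong Lefschetz property if such an $L$ exists. Given a $k$-linear basis $\mathbf{B}_d=\{\alpha^{(d)}_i\}_i$ of $A_d$ (represented by homogeneous polynomials of degree $d>0$ in $Q$), the $d$-th Hessian of $F$ with respect to $\mathbf{B}_d$ is the polynomial $$\mathrm{Hess}^{(d)}_{\mathbf{B}_d}F=\det\Big(\big(\alpha^{(d)}_i(X)\,\alpha^{(d)}_j(X)\,F(x)\big)_{i,j=1}^{\dim_k A_d}\Big)\in k[x_1,\ldots,x_n].$$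
   Formalization: Part (2) is proved for socle degree 2 ≤ D < 5 only: for D = 1 it is false, since the first Hessian of a linear form F is always zero, while L is a strong Lefschetz element whenever F(a) ≠ 0 (e.g. F = x, L = X). *)

theory Defs
  imports
    "HOL-Library.Poly_Mapping"
    "HOL-Algebra.QuotRing"
    "HOL-Algebra.Embedded_Algebras"
    "Jordan_Normal_Form.VS_Connect"
    "Jordan_Normal_Form.Determinant"
begin

text \<open>
  Polynomials in finitely many variables indexed by \<open>'n\<close> over \<open>'k\<close>: a polynomial maps an
  exponent vector to its coefficient.  The same type serves for \<open>k[x\<^sub>1,\<dots>,x\<^sub>n]\<close> and for the ring
  \<open>Q = k[X\<^sub>1,\<dots>,X\<^sub>n]\<close> of differential operators.
\<close>

type_synonym ('n, 'k) mpoly = "('n \<Rightarrow>\<^sub>0 nat) \<Rightarrow>\<^sub>0 'k"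

definition mconst :: "'k::zero \<Rightarrow> ('n, 'k) mpoly" where
  "mconst c = Poly_Mapping.single 0 c"

definition mvar :: "'n \<Rightarrow> ('n, 'k::zero_neq_one) mpoly" where
  "mvar i = Poly_Mapping.single (Poly_Mapping.single i 1) 1"

definition mdegree :: "('n::finite \<Rightarrow>\<^sub>0 nat) \<Rightarrow> nat" where
  "mdegree m = (\<Sum>i\<in>UNIV. Poly_Mapping.lookup m i)"

definition homogeneous :: "nat \<Rightarrow> ('n::finite, 'k::zero) mpoly \<Rightarrow> bool" where
  "homogeneous d p \<longleftrightarrow> (\<forall>m\<in>Poly_Mapping.keys p. mdegree m = d)"

definition meval :: "('n::finite \<Rightarrow> 'k::comm_semiring_1) \<Rightarrow> ('n, 'k) mpoly \<Rightarrow> 'k" where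
  "meval a p = (\<Sum>m\<in>Poly_Mapping.keys p. Poly_Mapping.lookup p m * (\<Prod>i\<in>UNIV. a i ^ Poly_Mapping.lookup m i))"

text \<open>
  Subtraction of exponents is truncated, which is harmless: where it truncates, the factor
  \<^term>\<open>of_nat (Poly_Mapping.lookup m i)\<close> vanishes.
\<close>

definition partial :: "'n \<Rightarrow> ('n, 'k::comm_semiring_1) mpoly \<Rightarrow> ('n, 'k) mpoly" where
  "partial i p = (\<Sum>m\<in>Poly_Mapping.keys p.
     Poly_Mapping.single (m - Poly_Mapping.single i 1) (of_nat (Poly_Mapping.lookup m i) * Poly_Mapping.lookup p m))"

lemma lookup_partial:
  "Poly_Mapping.lookup (partial i p) m = of_nat (Suc (Poly_Mapping.lookup m i)) * Poly_Mapping.lookup p (m + Poly_Mapping.single i 1)"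
proof -
  let ?e = "Poly_Mapping.single i (1::nat)"
  let ?f = "\<lambda>m'. of_nat (Poly_Mapping.lookup m' i) * Poly_Mapping.lookup p m'"
  have *: "(?f m' when m' - ?e = m) = (?f m' when m' = m + ?e)" for m'
  proof (cases "Poly_Mapping.lookup m' i = 0")
    case True
    hence "m' \<noteq> m + ?e" by (auto simp: lookup_add)
    with True show ?thesis by simp
  next
    case False
    hence "(m' - ?e) + ?e = m'"
      by (intro poly_mapping_eqI) (auto simp: lookup_add lookup_minus lookup_single when_def)
    hence "m' - ?e = m \<longleftrightarrow> m' = m + ?e" by auto
    thus ?thesis by simp
  qed
  have "Poly_Mapping.lookup (partial i p) m = (\<Sum>m'\<in>Poly_Mapping.keys p. ?f m' when m' - ?e = m)"
    by (simp add: partial_def lookup_sum lookup_single)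
  also have "\<dots> = (\<Sum>m'\<in>Poly_Mapping.keys p. ?f m' when m' = m + ?e)"
    by (simp only: *)
  also have "\<dots> = ?f (m + ?e)"
    by (auto simp: when_def in_keys_iff)
  finally show ?thesis by (simp add: lookup_add)
qed

lemma partial_commute: "partial i (partial j p) = partial j (partial i p)"
  by (rule poly_mapping_eqI, cases "i = j")
    (simp_all add: lookup_partial lookup_add lookup_single ac_simps)

text \<open>
  The operator \<open>\<partial>\<^sup>m\<close>, the product of the powers \<open>\<partial>\<^sub>i ^ m\<^sub>i\<close>; the order of composition is immaterial.
\<close>

definition diff_monom :: "('n::finite \<Rightarrow>\<^sub>0 nat) \<Rightarrow> ('n, 'k::comm_semiring_1) mpoly \<Rightarrow> ('n, 'k) mpoly" where
  "diff_monom m p = Finite_Set.fold (\<lambda>i. partial i ^^ Poly_Mapping.lookup m i) p UNIV"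

lemma comp_fun_commute_partial_pow:
  "comp_fun_commute (\<lambda>i. partial i ^^ e i :: ('n, 'k::comm_semiring_1) mpoly \<Rightarrow> _)"
proof
  fix i j :: 'n
  have 1: "(partial i ^^ a) (partial j p) = partial j ((partial i ^^ a) p)"
    for a and p :: "('n, 'k) mpoly"
    by (induction a) (simp_all add: partial_commute[of i j])
  have "(partial j ^^ b) ((partial i ^^ a) p) = (partial i ^^ a) ((partial j ^^ b) p)"
    for a b and p :: "('n, 'k) mpoly"
    by (induction b) (simp_all add: 1)
  thus "(partial j ^^ e j) \<circ> (partial i ^^ e i) =
      ((partial i ^^ e i) \<circ> (partial j ^^ e j) :: ('n, 'k) mpoly \<Rightarrow> _)"
    by (simp add: fun_eq_iff)
qed

text \<open>\<open>a(\<partial>\<^sub>1,\<dots>,\<partial>\<^sub>n) p\<close>\<close>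

definition diff_act :: "('n::finite, 'k::comm_semiring_1) mpoly \<Rightarrow> ('n, 'k) mpoly \<Rightarrow> ('n, 'k) mpoly" where
  "diff_act a p = (\<Sum>m\<in>Poly_Mapping.keys a. mconst (Poly_Mapping.lookup a m) * diff_monom m p)"

definition Ann :: "('n::finite, 'k::comm_semiring_1) mpoly \<Rightarrow> ('n, 'k) mpoly set" where
  "Ann F = {a. diff_act a F = 0}"

text \<open>\<^term>\<open>class_ring\<close> is the ring of a type; here it is \<open>Q\<close>.\<close>

definition gor_alg :: "('n::finite, 'k::comm_ring_1) mpoly \<Rightarrow> ('n, 'k) mpoly set ring" where
  "gor_alg F = class_ring Quot Ann F"

definition gor_class :: "('n::finite, 'k::comm_ring_1) mpoly \<Rightarrow> ('n, 'k) mpoly \<Rightarrow> ('n, 'k) mpoly set" where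
  "gor_class F a = Ann F +>\<^bsub>class_ring\<^esub> a"

definition gor_scalars :: "('n::finite, 'k::comm_ring_1) mpoly \<Rightarrow> ('n, 'k) mpoly set set" where
  "gor_scalars F = gor_class F ` range mconst"

definition gor_part :: "('n::finite, 'k::comm_ring_1) mpoly \<Rightarrow> nat \<Rightarrow> ('n, 'k) mpoly set set" where
  "gor_part F d = gor_class F ` {a. homogeneous d a}"

definition strong_Lefschetz_element ::
    "('n::finite, 'k::comm_ring_1) mpoly \<Rightarrow> nat \<Rightarrow> ('n, 'k) mpoly set \<Rightarrow> bool" where
  "strong_Lefschetz_element F D L \<longleftrightarrow>
     L \<in> gor_part F 1 \<and>
     (\<forall>i \<le> D div 2.
        bij_betw (\<lambda>x. (L [^]\<^bsub>gor_alg F\<^esub> (D - 2 * i)) \<otimes>\<^bsub>gor_alg F\<^esub> x)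
          (gor_part F i) (gor_part F (D - i)))"

definition strong_Lefschetz_property :: "('n::finite, 'k::comm_ring_1) mpoly \<Rightarrow> nat \<Rightarrow> bool" where
  "strong_Lefschetz_property F D \<longleftrightarrow> (\<exists>L. strong_Lefschetz_element F D L)"

text \<open>
  A basis of \<open>A\<^sub>d\<close> is given by a list of representatives in \<open>Q\<close>, homogeneous of degree \<open>d\<close>.
\<close>

definition gor_basis :: "('n::finite, 'k::comm_ring_1) mpoly \<Rightarrow> nat \<Rightarrow> ('n, 'k) mpoly list \<Rightarrow> bool" where
  "gor_basis F d B \<longleftrightarrow>
     (\<forall>b\<in>set B. homogeneous d b) \<and>
     ring.independent (gor_alg F) (gor_scalars F) (map (gor_class F) B) \<and>
     ring.Span (gor_alg F) (gor_scalars F) (map (gor_class F) B) = gor_part F d"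

definition Hess :: "('n::finite, 'k::comm_ring_1) mpoly list \<Rightarrow> ('n, 'k) mpoly \<Rightarrow> ('n, 'k) mpoly" where
  "Hess B F = det (mat (length B) (length B) (\<lambda>(i, j). diff_act (B ! i * B ! j) F))"

end

theory Submission
  imports Defs
begin

text \<open>
  Let \<open>L = a\<^sub>1 X\<^sub>1 + \<dots> + a\<^sub>n X\<^sub>n\<close> and \<open>e = D - 2 d\<close>.  For \<open>\<alpha>, \<beta>\<close> homogeneous of degree \<open>d\<close>, Euler's
  identity gives \<open>L\<^sup>e \<alpha> \<beta> F = e! (\<alpha> \<beta> F)(a)\<close>.  So up to the factor \<open>e!\<close> the matrix of the
  Hessian at \<open>a\<close> is the matrix of the bilinear form \<open>(\<alpha>, \<beta>) \<mapsto> L\<^sup>e \<alpha> \<beta> F\<close> on \<open>A\<^sub>d\<close>, and since the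
  pairing of \<open>A\<^sub>d\<close> with \<open>A\<^bsub>D-d\<^esub>\<close> is perfect, it is invertible iff \<open>L\<^sup>e : A\<^sub>d \<rightarrow> A\<^bsub>D-d\<^esub>\<close> is bijective.
  For \<open>d = 0\<close> this condition is \<open>F(a) \<noteq> 0\<close>, for \<open>2 d = D\<close> bijectivity is automatic, and finitely many nonzero
  polynomials have a common point of non-vanishing.
\<close>

section \<open>Polynomials\<close>

lemma mconst_0 [simp]: "mconst 0 = 0"
  and mconst_1 [simp]: "mconst 1 = 1"
  by (simp_all add: mconst_def)

lemma mconst_mult: "mconst (a * b) = mconst a * (mconst b :: ('n, 'k::comm_semiring_1) mpoly)"
  by (simp add: mconst_def mult_single)

lemma mconst_uminus: "mconst (- a) = - (mconst a :: ('n, 'k::comm_ring_1) mpoly)"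
  by (simp add: mconst_def single_uminus)

lemma lookup_mconst_mult:
  "Poly_Mapping.lookup (mconst c * p) u = c * Poly_Mapping.lookup (p :: ('n, 'k::comm_semiring_1) mpoly) u"
  unfolding mconst_def mult_map_scale_conv_mult [symmetric]
  by (simp add: Poly_Mapping.map.rep_eq when_def)

lemma mpoly_eq_sum_single:
  "(p :: ('n, 'k::comm_semiring_1) mpoly) = (\<Sum>m\<in>Poly_Mapping.keys p. Poly_Mapping.single m (Poly_Mapping.lookup p m))"
  by (rule poly_mapping_eqI)
    (auto simp: lookup_sum lookup_single when_def not_in_keys_iff_lookup_eq_zero sum.delta')

text \<open>Every polynomial is a finite sum of monomials, so bilinear identities need checking on
  monomials only. The zero polynomial is covered by \<open>single\<close> with coefficient
  0.\<close>

lemma mpoly_induct [case_names single add]: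
  assumes single: "\<And>m c. P (Poly_Mapping.single m c)"
    and add: "\<And>p q. P p \<Longrightarrow> P q \<Longrightarrow> P (p + q)"
  shows "P (p :: ('n, 'k::comm_semiring_1) mpoly)"
proof -
  have "P (\<Sum>m\<in>A. Poly_Mapping.single m (Poly_Mapping.lookup p m))" if "finite A" for A
    using that
  proof (induction A)
    case empty
    show ?case using single [of undefined 0] by simp
  next
    case (insert m A)
    then show ?case using single add by simp
  qed
  from this [of "Poly_Mapping.keys p"] show ?thesis
    by (simp flip: mpoly_eq_sum_single)
qed

lemma sum_single_lookup:
  "(\<Sum>i\<in>UNIV. Poly_Mapping.single i (Poly_Mapping.lookup m i)) = (m :: 'n::finite \<Rightarrow>\<^sub>0 nat)"
  by (rule poly_mapping_eqI) (simp add: lookup_sum lookup_single when_def)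


section \<open>Homogeneity and evaluation\<close>

lemma mdegree_add: "mdegree (u + v) = mdegree u + mdegree v"
  by (simp add: mdegree_def lookup_add sum.distrib)

lemma mdegree_0 [simp]: "mdegree 0 = 0"
  by (simp add: mdegree_def)

lemma mdegree_eq_0_iff: "mdegree m = 0 \<longleftrightarrow> m = 0"
  by (auto simp: mdegree_def intro!: poly_mapping_eqI)

lemma mdegree_single [simp]: "mdegree (Poly_Mapping.single i n) = n"
  by (simp add: mdegree_def lookup_single when_def)

lemma homogeneous_iff:
  "homogeneous d p \<longleftrightarrow> (\<forall>m. Poly_Mapping.lookup p m \<noteq> 0 \<longrightarrow> mdegree m = d)"
  by (auto simp: homogeneous_def in_keys_iff)

lemma homogeneous_0 [simp]: "homogeneous d 0"
  by (simp add: homogeneous_def)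

lemma homogeneous_single: "mdegree m = d \<Longrightarrow> homogeneous d (Poly_Mapping.single m c)"
  by (simp add: homogeneous_def)

lemma homogeneous_1 [simp]: "homogeneous 0 (1 :: ('n::finite, 'k::comm_semiring_1) mpoly)"
  unfolding single_one [symmetric] by (rule homogeneous_single) simp

lemma homogeneous_mvar: "homogeneous 1 (mvar i)"
  unfolding mvar_def by (rule homogeneous_single) simp

lemma homogeneous_mconst: "homogeneous 0 (mconst c)"
  unfolding mconst_def by (rule homogeneous_single) simp

lemma homogeneous_add:
  "homogeneous d p \<Longrightarrow> homogeneous d q \<Longrightarrow> homogeneous d (p + q :: ('n::finite, 'k::comm_semiring_1) mpoly)"
  unfolding homogeneous_iff lookup_add by (metis add.right_neutral)

lemma homogeneous_diff:
  "homogeneous d p \<Longrightarrow> homogeneous d q \<Longrightarrow> homogeneous d (p - q :: ('n::finite, 'k::comm_ring_1) mpoly)"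
  unfolding homogeneous_iff lookup_minus by (metis diff_zero)

lemma homogeneous_sum:
  "(\<And>x. x \<in> A \<Longrightarrow> homogeneous d (f x :: ('n::finite, 'k::comm_semiring_1) mpoly)) \<Longrightarrow> homogeneous d (sum f A)"
  by (induction A rule: infinite_finite_induct) (auto intro: homogeneous_add)

lemma homogeneous_mult:
  assumes "homogeneous d p" "homogeneous e (q :: ('n::finite, 'k::comm_semiring_1) mpoly)"
  shows "homogeneous (d + e) (p * q)"
  using assms keys_mult [of p q] unfolding homogeneous_def by (fastforce simp: mdegree_add)

lemma homogeneous_power:
  "homogeneous d (p :: ('n::finite, 'k::comm_semiring_1) mpoly) \<Longrightarrow> homogeneous (n * d) (p ^ n)"
  by (induction n) (auto intro: homogeneous_mult)

lemma homogeneous_mconst_mult: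
  "homogeneous d p \<Longrightarrow> homogeneous d (mconst c * p :: ('n::finite, 'k::comm_semiring_1) mpoly)"
  using homogeneous_mult [OF homogeneous_mconst, of d p] by simp

section \<open>Evaluation at a point\<close>

lemma meval_single:
  "meval a (Poly_Mapping.single m c) = c * (\<Prod>i\<in>UNIV. a i ^ Poly_Mapping.lookup m i)"
  by (simp add: meval_def)

lemma meval_add: "meval a (p + q) = meval a p + meval a q"
  unfolding meval_def by (rule setsum_keys_plus_distrib) (simp_all add: algebra_simps)

lemma meval_0 [simp]: "meval a 0 = 0"
  by (simp add: meval_def)

lemma meval_sum: "meval a (sum f A) = (\<Sum>x\<in>A. meval a (f x))"
  by (induction A rule: infinite_finite_induct) (simp_all add: meval_add)

lemma meval_mult: "meval a (p * q) = meval a p * meval a q"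
proof (induction p rule: mpoly_induct)
  case (single m c)
  show ?case
  proof (induction q rule: mpoly_induct)
    case (single m' c')
    show ?case
      by (simp add: mult_single meval_single lookup_add power_add prod.distrib mult_ac)
  qed (simp only: distrib_left meval_add)
qed (simp only: distrib_right meval_add)

lemma meval_mconst [simp]: "meval a (mconst c) = c"
  by (simp add: mconst_def meval_single)

lemma meval_1 [simp]: "meval a 1 = 1"
  by (metis meval_mconst mconst_1)

lemma comm_ring_hom_meval: "comm_ring_hom (meval a :: ('n::finite, 'k::comm_ring_1) mpoly \<Rightarrow> 'k)"
  by unfold_locales (simp_all add: meval_add meval_mult)

text \<open>Only the exponent 0 has degree 0. This links the constant coefficient, through which the
  pairing is expressed, with values at a point.\<close>

lemma meval_homogeneous_0:
  assumes "homogeneous 0 p"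
  shows "meval a p = Poly_Mapping.lookup p 0"
proof -
  have "Poly_Mapping.keys p \<subseteq> {0}"
    using assms by (auto simp: homogeneous_def mdegree_eq_0_iff)
  hence "meval a p = (\<Sum>m\<in>{0}. Poly_Mapping.lookup p m * (\<Prod>i\<in>UNIV. a i ^ Poly_Mapping.lookup m i))"
    unfolding meval_def by (intro sum.mono_neutral_left) (auto simp: in_keys_iff)
  thus ?thesis by simp
qed


section \<open>The differential action\<close>

text \<open>The multi-index factorial u!, invertible in characteristic zero, so that rescaling
  coefficients by it loses nothing.\<close>

definition mfact :: "('n::finite \<Rightarrow>\<^sub>0 nat) \<Rightarrow> 'k::field_char_0" where
  "mfact u = (\<Prod>i\<in>UNIV. fact (Poly_Mapping.lookup u i))"

text \<open>In these normalized coefficients \<open>\<partial>\<^sup>m\<close> is just a shift of exponents by \<open>m\<close>.\<close>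

definition ecoeff :: "('n::finite, 'k::field_char_0) mpoly \<Rightarrow> ('n \<Rightarrow>\<^sub>0 nat) \<Rightarrow> 'k" where
  "ecoeff p u = mfact u * Poly_Mapping.lookup p u"

lemma mfact_nonzero [simp]: "mfact u \<noteq> 0"
  by (simp add: mfact_def)

lemma mfact_0 [simp]: "mfact 0 = 1"
  by (simp add: mfact_def)

lemma mfact_add_single:
  "mfact (u + Poly_Mapping.single i 1) = of_nat (Suc (Poly_Mapping.lookup u i)) * mfact u"
proof -
  have "mfact (u + Poly_Mapping.single i 1) =
      (\<Prod>j\<in>UNIV. (if j = i then of_nat (Suc (Poly_Mapping.lookup u i)) else 1) * fact (Poly_Mapping.lookup u j))"
    unfolding mfact_def by (rule prod.cong) (auto simp: lookup_add lookup_single)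
  thus ?thesis by (simp add: prod.distrib mfact_def)
qed

lemma mpoly_eq_ecoeffI: "(\<And>u. ecoeff p u = ecoeff q u) \<Longrightarrow> p = q"
  by (rule poly_mapping_eqI) (simp add: ecoeff_def)

lemma ecoeff_0 [simp]: "ecoeff 0 u = 0"
  by (simp add: ecoeff_def)

lemma ecoeff_add: "ecoeff (p + q) u = ecoeff p u + ecoeff q u"
  by (simp add: ecoeff_def lookup_add algebra_simps)

lemma ecoeff_sum: "ecoeff (sum f A) u = (\<Sum>x\<in>A. ecoeff (f x) u)"
  by (simp add: ecoeff_def lookup_sum sum_distrib_left)

lemma ecoeff_mconst_mult: "ecoeff (mconst c * p) u = c * ecoeff p u"
  by (simp add: ecoeff_def lookup_mconst_mult)

text \<open>The factor produced by differentiation is exactly the quotient of (u + e_i)! by u!, so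
  the normalization absorbs it.\<close>

lemma ecoeff_partial: "ecoeff (partial i p) u = ecoeff p (u + Poly_Mapping.single i 1)"
  by (simp only: ecoeff_def lookup_partial mfact_add_single mult_ac)

lemma ecoeff_partial_pow: "ecoeff ((partial i ^^ n) p) u = ecoeff p (u + Poly_Mapping.single i n)"
  by (induction n arbitrary: u) (simp_all add: ecoeff_partial add.assoc flip: single_add)

lemma ecoeff_diff_monom:
  fixes p :: "('n::finite, 'k::field_char_0) mpoly"
  shows "ecoeff (diff_monom m p) u = ecoeff p (u + m)"
proof -
  interpret comp_fun_commute
    "\<lambda>i. partial i ^^ Poly_Mapping.lookup m i :: ('n, 'k) mpoly \<Rightarrow> _"
    by (rule comp_fun_commute_partial_pow)
  \<comment> \<open>Each variable contributes its own shift, and over \<open>UNIV\<close> the shifts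
    add up to \<open>m\<close>. The exponent \<open>u\<close> must vary because every derivative
    moves it.\<close>
  have "ecoeff (Finite_Set.fold (\<lambda>i. partial i ^^ Poly_Mapping.lookup m i) p A) u =
      ecoeff p (u + (\<Sum>i\<in>A. Poly_Mapping.single i (Poly_Mapping.lookup m i)))" if "finite A" for A
    using that by (induction A arbitrary: u) (simp_all add: ecoeff_partial_pow add_ac)
  from this [of UNIV] show ?thesis
    by (simp add: diff_monom_def sum_single_lookup)
qed

lemma ecoeff_diff_act:
  "ecoeff (diff_act a p) u = (\<Sum>m\<in>Poly_Mapping.keys a. Poly_Mapping.lookup a m * ecoeff p (u + m))"
  by (simp add: diff_act_def ecoeff_sum ecoeff_mconst_mult ecoeff_diff_monom)

lemma ecoeff_diff_act_single: "ecoeff (diff_act (Poly_Mapping.single m c) p) u = c * ecoeff p (u + m)"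
  by (simp add: ecoeff_diff_act)

lemma diff_act_add: "diff_act (a + b) p = diff_act a p + diff_act b (p :: ('n::finite, 'k::field_char_0) mpoly)"
proof (rule mpoly_eq_ecoeffI)
  show "ecoeff (diff_act (a + b) p) u = ecoeff (diff_act a p + diff_act b p) u" for u
    unfolding ecoeff_add ecoeff_diff_act
    by (rule setsum_keys_plus_distrib) (simp_all add: algebra_simps)
qed

lemma diff_act_add_right:
  "diff_act a (p + q) = diff_act a p + diff_act a (q :: ('n::finite, 'k::field_char_0) mpoly)"
  by (rule mpoly_eq_ecoeffI) (simp add: ecoeff_add ecoeff_diff_act algebra_simps sum.distrib)

lemma diff_act_0 [simp]: "diff_act 0 p = 0"
  by (simp add: diff_act_def)

lemma diff_act_0_right [simp]: "diff_act a 0 = (0 :: ('n::finite, 'k::field_char_0) mpoly)"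
  by (rule mpoly_eq_ecoeffI) (simp add: ecoeff_diff_act)

lemma diff_act_diff:
  "diff_act (a - b) p = diff_act a p - diff_act b (p :: ('n::finite, 'k::field_char_0) mpoly)"
  using diff_act_add [of "a - b" b p] by simp

lemma diff_act_sum:
  "diff_act (sum f A) p = (\<Sum>x\<in>A. diff_act (f x) (p :: ('n::finite, 'k::field_char_0) mpoly))"
  by (induction A rule: infinite_finite_induct) (simp_all add: diff_act_add)

text \<open>This is the module structure over Q. Both sides are bilinear in \<open>a\<close> and
  \<open>b\<close>, and for monomials both shift exponents by \<open>m + m'\<close>.\<close>

lemma diff_act_mult:
  "diff_act (a * b) p = diff_act a (diff_act b (p :: ('n::finite, 'k::field_char_0) mpoly))"
proof (induction a rule: mpoly_induct)
  case (single m c)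
  show ?case
  proof (induction b rule: mpoly_induct)
    case (single m' c')
    show ?case
      by (rule mpoly_eq_ecoeffI) (simp add: mult_single ecoeff_diff_act_single ac_simps)
  qed (simp add: distrib_left diff_act_add diff_act_add_right)
qed (simp add: distrib_right diff_act_add)

lemma diff_act_mconst: "diff_act (mconst c) p = mconst c * (p :: ('n::finite, 'k::field_char_0) mpoly)"
  by (rule mpoly_eq_ecoeffI) (simp only: ecoeff_mconst_mult, simp add: mconst_def ecoeff_diff_act_single)

lemma diff_act_1 [simp]: "diff_act 1 p = (p :: ('n::finite, 'k::field_char_0) mpoly)"
  using diff_act_mconst [of 1 p] by simp

lemma diff_act_mvar: "diff_act (mvar i) p = partial i (p :: ('n::finite, 'k::field_char_0) mpoly)"
  by (rule mpoly_eq_ecoeffI) (simp only: mvar_def ecoeff_diff_act_single ecoeff_partial mult_1)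

text \<open>A surviving exponent \<open>u\<close> comes from some \<open>m\<close> in the support of
  \<open>a\<close> with \<open>u + m\<close> in the support of \<open>p\<close>, so degrees
  subtract.\<close>

lemma homogeneous_diff_act:
  fixes p :: "('n::finite, 'k::field_char_0) mpoly"
  assumes a: "homogeneous d a" and p: "homogeneous (d + e) p"
  shows "homogeneous e (diff_act a p)"
  unfolding homogeneous_iff
proof (intro allI impI)
  fix u assume "Poly_Mapping.lookup (diff_act a p) u \<noteq> 0"
  hence "ecoeff (diff_act a p) u \<noteq> 0" by (simp add: ecoeff_def)
  then obtain m where m: "m \<in> Poly_Mapping.keys a" and "ecoeff p (u + m) \<noteq> 0"
    unfolding ecoeff_diff_act by (metis (no_types, lifting) mult_zero_right sum.neutral)
  hence "mdegree (u + m) = d + e" using p by (auto simp: homogeneous_iff ecoeff_def)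
  moreover have "mdegree m = d" using a m by (auto simp: homogeneous_def)
  ultimately show "mdegree u = e" by (simp add: mdegree_add)
qed

text \<open>Perfectness of the pairing \<open>(a, b) \<mapsto> a(\<partial>) b(\<partial>) F\<close>: test against the monomials \<open>\<partial>\<^sup>u\<close>.\<close>

lemma diff_act_eq_0_if_pairing:
  fixes p :: "('n::finite, 'k::field_char_0) mpoly"
  assumes p: "homogeneous d p"
    and pairing: "\<And>b. homogeneous d b \<Longrightarrow> Poly_Mapping.lookup (diff_act b p) 0 = 0"
  shows "p = 0"
proof (rule mpoly_eq_ecoeffI)
  fix u
  show "ecoeff p u = ecoeff 0 u"
  proof (cases "mdegree u = d")
    case True
    have "ecoeff p u = ecoeff (diff_act (Poly_Mapping.single u 1) p) 0"
      by (simp add: ecoeff_diff_act_single)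
    also have "\<dots> = 0"
      using pairing [OF homogeneous_single [OF True]] by (simp add: ecoeff_def)
    finally show ?thesis by simp
  qed (use p in \<open>auto simp: homogeneous_iff ecoeff_def\<close>)
qed


section \<open>Linear forms and Euler's identity\<close>

definition linform :: "('n::finite \<Rightarrow> 'k::comm_semiring_1) \<Rightarrow> ('n, 'k) mpoly" where
  "linform a = (\<Sum>i\<in>UNIV. mconst (a i) * mvar i)"

lemma homogeneous_linform: "homogeneous 1 (linform a)"
  unfolding linform_def by (intro homogeneous_sum homogeneous_mconst_mult homogeneous_mvar)

lemma homogeneous_linform_power: "homogeneous n (linform a ^ n)"
  using homogeneous_power [OF homogeneous_linform, of n a] by simp

text \<open>Turns a candidate Lefschetz element into a point \<open>a\<close> at which to evaluate.
  The coordinates are the coefficients at the unit vectors, the only exponents of degree 1.\<close>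

lemma homogeneous_1_imp_linform:
  assumes "homogeneous 1 p"
  obtains a where "p = linform a"
proof
  show "p = linform (\<lambda>i. Poly_Mapping.lookup p (Poly_Mapping.single i 1))" (is "p = linform ?a")
  proof (rule poly_mapping_eqI)
    fix m
    have *: "Poly_Mapping.lookup (linform ?a) m =
        (\<Sum>i\<in>UNIV. if Poly_Mapping.single i 1 = m then ?a i else 0)"
      by (simp add: linform_def lookup_sum lookup_mconst_mult mvar_def lookup_single when_def if_distrib cong: if_cong)
    show "Poly_Mapping.lookup p m = Poly_Mapping.lookup (linform ?a) m"
    proof (cases "\<exists>j. m = Poly_Mapping.single j 1")
      case True
      then obtain j where m: "m = Poly_Mapping.single j 1" by blast
      have "Poly_Mapping.single i (1::nat) = Poly_Mapping.single j 1 \<longleftrightarrow> i = j" for i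
        by (metis lookup_single_eq lookup_single_not_eq zero_neq_one)
      with m show ?thesis unfolding * by simp
    next
      case False
      have "mdegree m \<noteq> 1"
      proof
        assume "mdegree m = 1"
        then obtain j where j: "Poly_Mapping.lookup m j = 1" "\<And>i. j \<noteq> i \<Longrightarrow> Poly_Mapping.lookup m i = 0"
          unfolding mdegree_def One_nat_def sum_eq_Suc0_iff [OF finite] by auto
        have "m = Poly_Mapping.single j 1"
          by (rule poly_mapping_eqI) (use j in \<open>auto simp: lookup_single when_def\<close>)
        with False show False by blast
      qed
      hence "Poly_Mapping.lookup p m = 0" using assms by (auto simp: homogeneous_iff)
      moreover have "Poly_Mapping.lookup (linform ?a) m = 0"
        unfolding * using False by (intro sum.neutral) auto
      ultimately show ?thesis by simp
    qed
  qed
qed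

text \<open>The factor \<open>a i\<close> restores the power that \<open>partial i\<close> removes.
  In monomials without the i-th variable the factor \<open>of_nat 0\<close> kills the term, so
  truncated subtraction does no harm.\<close>

lemma meval_partial:
  fixes p :: "('n::finite, 'k::comm_semiring_1) mpoly"
  shows "a i * meval a (partial i p) =
    (\<Sum>m\<in>Poly_Mapping.keys p. of_nat (Poly_Mapping.lookup m i) *
       (Poly_Mapping.lookup p m * (\<Prod>j\<in>UNIV. a j ^ Poly_Mapping.lookup m j)))"
proof -
  have *: "of_nat (Poly_Mapping.lookup m i) *
        (a i * (\<Prod>j\<in>UNIV. a j ^ Poly_Mapping.lookup (m - Poly_Mapping.single i 1) j)) =
      of_nat (Poly_Mapping.lookup m i) * (\<Prod>j\<in>UNIV. a j ^ Poly_Mapping.lookup m j)" for m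
  proof (cases "Poly_Mapping.lookup m i")
    case (Suc n)
    have "(\<Prod>j\<in>UNIV. a j ^ Poly_Mapping.lookup m j) = (\<Prod>j\<in>UNIV. (if j = i then a i else 1) *
        a j ^ Poly_Mapping.lookup (m - Poly_Mapping.single i 1) j)"
      by (rule prod.cong) (use Suc in \<open>auto simp: lookup_minus lookup_single\<close>)
    thus ?thesis by (simp add: prod.distrib)
  qed simp
  have "a i * meval a (partial i p) = (\<Sum>m\<in>Poly_Mapping.keys p. Poly_Mapping.lookup p m *
      (of_nat (Poly_Mapping.lookup m i) *
        (a i * (\<Prod>j\<in>UNIV. a j ^ Poly_Mapping.lookup (m - Poly_Mapping.single i 1) j))))"
    by (simp add: partial_def meval_sum meval_single sum_distrib_left mult_ac)
  thus ?thesis unfolding * by (simp add: mult_ac)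
qed

text \<open>At the point \<open>a\<close> the operator of \<open>linform a\<close> takes the same
  value as Euler's operator, which multiplies each monomial by its degree.\<close>

lemma euler_identity:
  fixes p :: "('n::finite, 'k::field_char_0) mpoly"
  assumes "homogeneous e p"
  shows "meval a (diff_act (linform a) p) = of_nat e * meval a p"
proof -
  let ?t = "\<lambda>m. Poly_Mapping.lookup p m * (\<Prod>j\<in>UNIV. a j ^ Poly_Mapping.lookup m j)"
  have "meval a (diff_act (linform a) p) = (\<Sum>i\<in>UNIV. a i * meval a (partial i p))"
    by (simp add: linform_def diff_act_sum diff_act_mult diff_act_mconst diff_act_mvar meval_sum meval_mult)
  also have "\<dots> = (\<Sum>m\<in>Poly_Mapping.keys p. \<Sum>i\<in>UNIV. of_nat (Poly_Mapping.lookup m i) * ?t m)"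
    unfolding meval_partial by (rule sum.swap)
  also have "\<dots> = (\<Sum>m\<in>Poly_Mapping.keys p. of_nat e * ?t m)"
  proof (rule sum.cong)
    fix m assume "m \<in> Poly_Mapping.keys p"
    hence "mdegree m = e" using assms by (simp add: homogeneous_def)
    thus "(\<Sum>i\<in>UNIV. of_nat (Poly_Mapping.lookup m i) * ?t m) = of_nat e * ?t m"
      by (simp add: mdegree_def flip: sum_distrib_right of_nat_sum)
  qed simp
  finally show ?thesis by (simp add: meval_def sum_distrib_left)
qed

text \<open>Euler's identity is iterated: the degree drops by one each time, so the factors e, e -
  1, ..., 1 accumulate. What remains is a constant, equal to its own value at
  \<open>a\<close>.\<close>

lemma lookup_linform_power:
  fixes p :: "('n::finite, 'k::field_char_0) mpoly"
  assumes "homogeneous e p"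
  shows "Poly_Mapping.lookup (diff_act (linform a ^ e) p) 0 = fact e * meval a p"
proof -
  have "meval a (diff_act (linform a ^ e) p) = fact e * meval a p"
    using assms
  proof (induction e arbitrary: p)
    case 0
    show ?case by simp
  next
    case (Suc e)
    have "homogeneous e (diff_act (linform a) p)"
      using homogeneous_diff_act [OF homogeneous_linform, of e p a] Suc.prems by simp
    \<comment> \<open>The induction hypothesis is applied to the derivative of \<open>p\<close>
      along \<open>a\<close>, whose value at \<open>a\<close> is again known from Euler's
      identity.\<close>
    from Suc.IH [OF this]
    have "meval a (diff_act (linform a ^ Suc e) p) = fact e * (of_nat (Suc e) * meval a p)"
      by (simp only: power_Suc2 diff_act_mult euler_identity [OF Suc.prems])
    thus ?case by (simp only: fact_Suc mult_ac of_nat_mult)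
  qed
  moreover have "homogeneous 0 (diff_act (linform a ^ e) p)"
    using homogeneous_diff_act [OF homogeneous_linform_power, of e 0 p a] assms by simp
  ultimately show ?thesis by (simp only: meval_homogeneous_0)
qed


section \<open>Common points of non-vanishing\<close>

text \<open>Reduction modulo \<open>N\<close> isolates the lowest digit of a base \<open>N\<close>
  expansion; cancelling it and dividing by \<open>N\<close> leaves a shorter expansion.\<close>

lemma digits_unique:
  fixes f g :: "nat \<Rightarrow> nat"
  assumes "\<And>i. i < n \<Longrightarrow> f i < N" "\<And>i. i < n \<Longrightarrow> g i < N"
    and "(\<Sum>i<n. f i * N ^ i) = (\<Sum>i<n. g i * N ^ i)" and "i < n"
  shows "f i = g i"
  using assms
proof (induction n arbitrary: f g i)
  case (Suc n)
  have shift: "(\<Sum>i<Suc n. h i * N ^ i) = h 0 + N * (\<Sum>i<n. h (Suc i) * N ^ i)" for h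
    unfolding sum.lessThan_Suc_shift by (simp add: sum_distrib_left mult_ac)
  have eq: "f 0 + N * (\<Sum>i<n. f (Suc i) * N ^ i) = g 0 + N * (\<Sum>i<n. g (Suc i) * N ^ i)"
    using Suc.prems(3) unfolding shift .
  have "f 0 < N" "g 0 < N" using Suc.prems by auto
  with eq have "f 0 = g 0" by (metis mod_less mod_mult_self2)
  moreover have "(\<Sum>i<n. f (Suc i) * N ^ i) = (\<Sum>i<n. g (Suc i) * N ^ i)"
    using eq \<open>f 0 = g 0\<close> \<open>f 0 < N\<close> by simp
  hence "f (Suc j) = g (Suc j)" if "j < n" for j
    using Suc.IH [of "\<lambda>i. f (Suc i)" "\<lambda>i. g (Suc i)" j] Suc.prems(1,2) that by auto
  ultimately show ?case using Suc.prems(4) by (cases i) auto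
qed simp

text \<open>Kronecker substitution \<open>x\<^sub>i \<mapsto> t ^ (N ^ i)\<close> with \<open>N\<close> larger than all exponents reduces
  to univariate polynomials.\<close>

lemma exists_common_nonzero_point:
  fixes \<G> :: "('n::finite, 'k::field_char_0) mpoly set"
  assumes "finite \<G>" and "0 \<notin> \<G>"
  shows "\<exists>a. \<forall>p\<in>\<G>. meval a p \<noteq> 0"
proof -
  let ?n = "card (UNIV :: 'n set)"
  \<comment> \<open>\<open>h\<close> numbers the variables and so assigns a digit position to
    each.\<close>
  obtain h :: "'n \<Rightarrow> nat" where h: "bij_betw h UNIV {..<?n}"
    using ex_bij_betw_finite_nat [of "UNIV :: 'n set"] by (auto simp: atLeast0LessThan)
  define K where "K = (\<Union>p\<in>\<G>. Poly_Mapping.keys p)"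
  have "finite K" using assms by (simp add: K_def)
  \<comment> \<open>One bound for all polynomials of the set at once: \<open>Suc\<close> makes every
    exponent a valid digit, and the inserted 0 keeps \<open>Max\<close> meaningful when there are no
    exponents.\<close>
  define N where "N = Suc (Max (insert 0 (mdegree ` K)))"
  have lt: "Poly_Mapping.lookup m i < N" if "m \<in> K" for m i
  proof -
    have "Poly_Mapping.lookup m i \<le> mdegree m"
      unfolding mdegree_def by (intro member_le_sum) auto
    also have "\<dots> \<le> Max (insert 0 (mdegree ` K))"
      using \<open>finite K\<close> that by (intro Max_ge) auto
    finally show ?thesis by (simp add: N_def)
  qed
  \<comment> \<open>The degree in t of the monomial \<open>m\<close> after the substitution:
    \<open>m\<close> read as a number in base \<open>N\<close>.\<close>
  define w where "w m = (\<Sum>i\<in>UNIV. Poly_Mapping.lookup m i * N ^ h i)" for m :: "'n \<Rightarrow>\<^sub>0 nat"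
  have w_eq: "w m = (\<Sum>i<?n. Poly_Mapping.lookup m (inv_into UNIV h i) * N ^ i)" for m
    unfolding w_def using h
    by (subst sum.reindex_bij_betw [OF h, symmetric]) (simp add: bij_betw_def)
  have inj: "inj_on w K"
  proof (rule inj_onI)
    fix m m' assume m: "m \<in> K" "m' \<in> K" and "w m = w m'"
    hence *: "Poly_Mapping.lookup m (inv_into UNIV h i) = Poly_Mapping.lookup m' (inv_into UNIV h i)"
      if "i < ?n" for i
      using digits_unique [of ?n "\<lambda>i. Poly_Mapping.lookup m (inv_into UNIV h i)" N
          "\<lambda>i. Poly_Mapping.lookup m' (inv_into UNIV h i)" i] m \<open>w m = w m'\<close> that
      by (simp add: lt w_eq)
    show "m = m'"
    proof (rule poly_mapping_eqI)
      fix i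
      have "h i < ?n" using bij_betwE [OF h] by simp
      from * [OF this] show "Poly_Mapping.lookup m i = Poly_Mapping.lookup m' i"
        using h by (simp add: bij_betw_def)
    qed
  qed
  define P where "P p = (\<Sum>m\<in>Poly_Mapping.keys p. monom (Poly_Mapping.lookup p m) (w m))"
    for p :: "('n, 'k) mpoly"
  have poly_P: "poly (P p) t = meval (\<lambda>i. t ^ N ^ h i) p" for p t
    by (simp add: P_def poly_sum poly_monom meval_def w_def power_sum mult.commute flip: power_mult)
  have "P p \<noteq> 0" if "p \<in> \<G>" for p
  proof -
    from that assms have "Poly_Mapping.keys p \<noteq> {}" by auto
    then obtain m where m: "m \<in> Poly_Mapping.keys p" by blast
    \<comment> \<open>Since \<open>w\<close> is injective on \<open>K\<close>, no two monomials of
      \<open>p\<close> collide, and the coefficient at \<open>m\<close> survives unchanged.\<close>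
    have "coeff (P p) (w m) = (\<Sum>m'\<in>Poly_Mapping.keys p. if m' = m then Poly_Mapping.lookup p m' else 0)"
      unfolding P_def coeff_sum using m that inj
      by (intro sum.cong) (auto simp: K_def inj_on_def)
    also have "\<dots> \<noteq> 0" using m by (simp add: in_keys_iff)
    finally show ?thesis by auto
  qed
  \<comment> \<open>Finitely many nonzero univariate polynomials have finitely many roots in total,
    while a field of characteristic zero is infinite.\<close>
  hence "finite (\<Union>p\<in>\<G>. {t. poly (P p) t = 0})"
    using assms(1) by (auto simp: poly_roots_finite)
  then obtain t where "t \<notin> (\<Union>p\<in>\<G>. {t. poly (P p) t = 0})"
    using infinite_UNIV_char_0 ex_new_if_finite by blast
  hence "\<forall>p\<in>\<G>. meval (\<lambda>i. t ^ N ^ h i) p \<noteq> 0"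
    by (simp add: poly_P)
  thus ?thesis by blast
qed


section \<open>The Gorenstein algebra\<close>

text \<open>Two representatives differ by an element of \<open>Ann F\<close> exactly when they act
  equally on \<open>F\<close>. Thus A embeds by a -> aF, and questions about classes become
  questions about polynomials.\<close>

lemma gor_class_eq_Collect:
  fixes F :: "('n::finite, 'k::field_char_0) mpoly"
  shows "gor_class F a = {x. diff_act x F = diff_act a F}"
proof -
  have "x \<in> gor_class F a \<longleftrightarrow> (\<exists>h. diff_act h F = 0 \<and> x = h + a)" for x
    by (auto simp: gor_class_def a_r_coset_def' Ann_def)
  also have "\<dots> x \<longleftrightarrow> diff_act x F = diff_act a F" for x
    by (auto simp: diff_act_add diff_act_diff intro!: exI [of _ "x - a"])
  finally show ?thesis by blast
qed

lemma gor_class_eq_iff: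
  "gor_class F a = gor_class F b \<longleftrightarrow> diff_act a F = diff_act b (F :: ('n::finite, 'k::field_char_0) mpoly)"
  by (auto simp: gor_class_eq_Collect)

lemma ideal_Ann: "ideal (Ann (F :: ('n::finite, 'k::field_char_0) mpoly)) class_ring"
proof (rule idealI)
  show "subgroup (Ann F) (add_monoid class_ring)"
  proof (rule group.subgroupI)
    show "group (add_monoid (class_ring :: ('n, 'k) mpoly ring))"
      using class_ring.add.is_group by simp
    have "- a \<in> Ann F" if "a \<in> Ann F" for a
      using that diff_act_diff [of 0 a F] by (simp add: Ann_def)
    thus "inv\<^bsub>add_monoid class_ring\<^esub> a \<in> Ann F" if "a \<in> Ann F" for a
      using that unfolding a_inv_def [symmetric] unfolding class_ring_simps .
  qed (auto simp: Ann_def diff_act_add intro: exI [of _ 0])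
next
  fix a x assume "a \<in> Ann F"
  hence "x * a \<in> Ann F" by (simp add: Ann_def diff_act_mult)
  thus "x \<otimes>\<^bsub>class_ring\<^esub> a \<in> Ann F" "a \<otimes>\<^bsub>class_ring\<^esub> x \<in> Ann F"
    by (simp_all add: mult.commute)
qed (rule class_ring.ring_axioms)

lemma gor_class_hom:
  "ring_hom_ring class_ring (gor_alg F) (gor_class (F :: ('n::finite, 'k::field_char_0) mpoly))"
  using ideal.rcos_ring_hom_ring [OF ideal_Ann, of F]
  unfolding gor_alg_def gor_class_def [abs_def] .

lemma ring_gor_alg: "ring (gor_alg (F :: ('n::finite, 'k::field_char_0) mpoly))"
  using gor_class_hom by (rule ring_hom_ring.axioms(2))

context
  fixes F :: "('n::finite, 'k::field_char_0) mpoly"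
begin

interpretation hom: ring_hom_ring class_ring "gor_alg F" "gor_class F"
  by (rule gor_class_hom)

lemma gor_class_mult: "gor_class F a \<otimes>\<^bsub>gor_alg F\<^esub> gor_class F b = gor_class F (a * b)"
  using hom.hom_mult [of a b] by simp

lemma gor_class_add: "gor_class F a \<oplus>\<^bsub>gor_alg F\<^esub> gor_class F b = gor_class F (a + b)"
  using hom.hom_add [of a b] by simp

lemma gor_class_zero: "\<zero>\<^bsub>gor_alg F\<^esub> = gor_class F 0"
  using hom.hom_zero by simp

lemma gor_class_one: "\<one>\<^bsub>gor_alg F\<^esub> = gor_class F 1"
  using hom.hom_one by simp

lemma gor_class_pow: "gor_class F a [^]\<^bsub>gor_alg F\<^esub> (n::nat) = gor_class F (a ^ n)"
  by (induction n) (simp_all add: gor_class_one gor_class_mult mult.commute)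

end


section \<open>Coordinates and bases in a graded piece\<close>

definition lincomb :: "(nat \<Rightarrow> 'k::comm_ring_1) \<Rightarrow> ('n, 'k) mpoly list \<Rightarrow> ('n, 'k) mpoly" where
  "lincomb c B = (\<Sum>i<length B. mconst (c i) * B ! i)"

lemma lincomb_Nil [simp]: "lincomb c [] = 0"
  by (simp add: lincomb_def)

lemma lincomb_Cons: "lincomb c (b # B) = mconst (c 0) * b + lincomb (\<lambda>i. c (Suc i)) B"
  unfolding lincomb_def list.size(4) add_0_right add_Suc_right sum.lessThan_Suc_shift by simp

lemma lincomb_scale: "lincomb (\<lambda>i. k * c i) B = mconst k * lincomb c B"
  by (simp add: lincomb_def mconst_mult sum_distrib_left mult.assoc)

lemma homogeneous_lincomb:
  fixes B :: "('n::finite, 'k::comm_ring_1) mpoly list"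
  shows "(\<And>b. b \<in> set B \<Longrightarrow> homogeneous d b) \<Longrightarrow> homogeneous d (lincomb c B)"
  unfolding lincomb_def by (intro homogeneous_sum homogeneous_mconst_mult) simp

text \<open>\<open>Span\<close> grows by one line extension per list element, just as
  \<open>lincomb\<close> grows in \<open>lincomb_Cons\<close>.\<close>

lemma Span_gor_class:
  fixes F :: "('n::finite, 'k::field_char_0) mpoly"
  shows "ring.Span (gor_alg F) (gor_scalars F) (map (gor_class F) B) = gor_class F ` range (\<lambda>c. lincomb c B)"
proof (induction B)
  case Nil
  show ?case by (simp add: ring.Span.simps [OF ring_gor_alg] gor_class_zero)
next
  case (Cons b B)
  have "x \<in> ring.Span (gor_alg F) (gor_scalars F) (map (gor_class F) (b # B)) \<longleftrightarrow>
      (\<exists>k c. x = gor_class F (mconst k * b + lincomb c B))" for x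
  proof -
    have "ring.Span (gor_alg F) (gor_scalars F) (map (gor_class F) (b # B)) =
        ring.line_extension (gor_alg F) (gor_scalars F) (gor_class F b)
          (ring.Span (gor_alg F) (gor_scalars F) (map (gor_class F) B))"
      by (simp add: ring.Span.simps [OF ring_gor_alg])
    thus ?thesis unfolding Cons.IH
      by (auto simp: ring.line_extension_mem_iff [OF ring_gor_alg] gor_scalars_def gor_class_mult gor_class_add)
  qed
  also have "(\<exists>k c. x = gor_class F (mconst k * b + lincomb c B)) \<longleftrightarrow>
      (\<exists>c. x = gor_class F (lincomb c (b # B)))" for x
    unfolding lincomb_Cons
  proof (intro iffI; elim exE)
    fix k c assume "x = gor_class F (mconst k * b + lincomb c B)"
    \<comment> \<open>\<open>case_nat k c\<close> puts \<open>k\<close> in front of the coefficient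
      sequence \<open>c\<close>.\<close>
    thus "\<exists>c. x = gor_class F (mconst (c 0) * b + lincomb (\<lambda>i. c (Suc i)) B)"
      by (intro exI [of _ "case_nat k c"]) simp
  qed blast
  finally show ?case by (simp add: set_eq_iff image_iff del: list.map)
qed

text \<open>\<open>independent\<close> is inductive: each list element lies outside the span of
  those after it. A nonzero leading coefficient would allow solving the relation for the head and so
  put it in that span; the other coefficients follow by induction.\<close>

lemma independent_gor_class:
  fixes F :: "('n::finite, 'k::field_char_0) mpoly"
  assumes "ring.independent (gor_alg F) (gor_scalars F) (map (gor_class F) B)"
    and "diff_act (lincomb c B) F = 0" and "i < length B"
  shows "c i = 0"
  using assms
proof (induction B arbitrary: c i)
  case (Cons b B)
  have indep: "ring.independent (gor_alg F) (gor_scalars F) (map (gor_class F) B)"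
    and notin: "gor_class F b \<notin> gor_class F ` range (\<lambda>c. lincomb c B)"
    using Cons.prems(1) ring.independent_backwards [OF ring_gor_alg] by (auto simp flip: Span_gor_class)
  let ?c = "\<lambda>i. c (Suc i)"
  have rel: "mconst (c 0) * diff_act b F + diff_act (lincomb ?c B) F = 0"
    using Cons.prems(2) by (simp add: lincomb_Cons diff_act_add diff_act_mult diff_act_mconst)
  have "c 0 = 0"
  proof (rule ccontr)
    assume "c 0 \<noteq> 0"
    \<comment> \<open>The scalar that solves the relation for \<open>b\<close>.\<close>
    define k where "k = - inverse (c 0)"
    have k: "mconst k * (mconst (c 0) :: ('n, 'k) mpoly) = - 1"
      using \<open>c 0 \<noteq> 0\<close> by (simp add: k_def mconst_uminus flip: mconst_mult)
    have "diff_act (lincomb (\<lambda>i. k * ?c i) B) F = mconst k * diff_act (lincomb ?c B) F"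
      by (simp add: lincomb_scale diff_act_mult diff_act_mconst)
    also have "diff_act (lincomb ?c B) F = - (mconst (c 0) * diff_act b F)"
      using rel by (simp add: add_eq_0_iff)
    also have "mconst k * - (mconst (c 0) * diff_act b F) = diff_act b F"
      using k by (simp flip: mult.assoc)
    finally have "gor_class F b = gor_class F (lincomb (\<lambda>i. k * ?c i) B)"
      by (simp add: gor_class_eq_iff)
    with notin show False by blast
  qed
  moreover have "?c j = 0" if "j < length B" for j
    using rel \<open>c 0 = 0\<close> Cons.IH [OF indep _ that] by simp
  ultimately show ?case using Cons.prems(3) by (cases i) auto
qed simp

text \<open>The basis condition transported along a -> aF to coefficient functions, so that matrices
  over the field apply directly.\<close>

definition rep_basis :: "('n::finite, 'k::comm_ring_1) mpoly \<Rightarrow> nat \<Rightarrow> ('n, 'k) mpoly list \<Rightarrow> bool" where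
  "rep_basis F d B \<longleftrightarrow>
     (\<forall>b\<in>set B. homogeneous d b) \<and>
     (\<forall>c. diff_act (lincomb c B) F = 0 \<longrightarrow> (\<forall>i<length B. c i = 0)) \<and>
     (\<forall>x. homogeneous d x \<longrightarrow> (\<exists>c. diff_act x F = diff_act (lincomb c B) F))"

lemma gor_basis_imp_rep_basis:
  fixes F :: "('n::finite, 'k::field_char_0) mpoly"
  assumes "gor_basis F d B"
  shows "rep_basis F d B"
  unfolding rep_basis_def
proof (intro conjI allI impI)
  show "\<forall>b\<in>set B. homogeneous d b" using assms by (simp add: gor_basis_def)
next
  fix c i assume "diff_act (lincomb c B) F = 0" "i < length B"
  thus "c i = 0" using assms independent_gor_class unfolding gor_basis_def by blast
next
  fix x :: "('n, 'k) mpoly" assume "homogeneous d x"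
  hence "gor_class F x \<in> gor_class F ` range (\<lambda>c. lincomb c B)"
    using assms by (auto simp: gor_basis_def gor_part_def Span_gor_class)
  thus "\<exists>c. diff_act x F = diff_act (lincomb c B) F"
    by (auto simp: gor_class_eq_iff)
qed

text \<open>A_0 consists of scalars and is nonzero because \<open>F\<close> is. Together with
  \<open>Hess_one\<close> this makes the degree 0 condition a case of the Hessian criterion.\<close>

lemma rep_basis_one:
  fixes F :: "('n::finite, 'k::field_char_0) mpoly"
  assumes "F \<noteq> 0"
  shows "rep_basis F 0 [1]"
proof -
  have "c = 0" if "mconst c * F = 0" for c
  proof -
    obtain u where "Poly_Mapping.lookup F u \<noteq> 0"
      using assms by (metis lookup_zero poly_mapping_eqI)
    thus ?thesis using arg_cong [OF that, of "\<lambda>p. Poly_Mapping.lookup p u"]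
      by (simp add: lookup_mconst_mult)
  qed
  moreover have "\<exists>c. diff_act x F = mconst (c 0) * F" if "homogeneous 0 x" for x :: "('n, 'k) mpoly"
  proof -
    have "x = mconst (Poly_Mapping.lookup x 0)"
    proof (rule poly_mapping_eqI)
      show "Poly_Mapping.lookup x m = Poly_Mapping.lookup (mconst (Poly_Mapping.lookup x 0)) m" for m
        using that by (cases "m = 0") (auto simp: mconst_def lookup_single homogeneous_iff mdegree_eq_0_iff)
    qed
    hence "diff_act x F = mconst (Poly_Mapping.lookup x 0) * F" by (metis diff_act_mconst)
    thus ?thesis by (intro exI [of _ "\<lambda>_. Poly_Mapping.lookup x 0"])
  qed
  ultimately show ?thesis
    by (auto simp: rep_basis_def lincomb_Cons diff_act_mconst)
qed

lemma Hess_one: "Hess [1] F = (F :: ('n::finite, 'k::field_char_0) mpoly)"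
  unfolding Hess_def by (subst det_single) auto


section \<open>The Lefschetz maps and the Hessians\<close>

text \<open>By linearity injectivity is a statement about the kernel, and classes are replaced by
  representatives. For 2d = D the power of L is 1 and both conditions become trivial.\<close>

lemma lefschetz_map_bij_iff:
  fixes F :: "('n::finite, 'k::field_char_0) mpoly"
  assumes "2 * d \<le> D"
  shows "bij_betw (\<lambda>x. (gor_class F (linform a) [^]\<^bsub>gor_alg F\<^esub> (D - 2 * d)) \<otimes>\<^bsub>gor_alg F\<^esub> x)
      (gor_part F d) (gor_part F (D - d)) \<longleftrightarrow>
    (\<forall>x. homogeneous d x \<and> diff_act (linform a ^ (D - 2 * d) * x) F = 0 \<longrightarrow> diff_act x F = 0) \<and>
    (\<forall>y. homogeneous (D - d) y \<longrightarrow>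
      (\<exists>x. homogeneous d x \<and> diff_act (linform a ^ (D - 2 * d) * x) F = diff_act y F))"
    (is "bij_betw ?f _ _ \<longleftrightarrow> ?inj \<and> ?surj")
proof -
  let ?L = "linform a ^ (D - 2 * d)"
  have f: "?f (gor_class F x) = gor_class F (?L * x)" for x
    by (simp add: gor_class_pow gor_class_mult)
  \<comment> \<open>\<open>2 * d \<le> D\<close> guarantees \<open>D - 2 * d + d = D - d\<close>
    despite truncated subtraction. So the image always lies in the target, and surjectivity is only
    the reverse inclusion.\<close>
  have hom: "homogeneous (D - d) (?L * x)" if "homogeneous d x" for x :: "('n, 'k) mpoly"
    using homogeneous_mult [OF homogeneous_linform_power that, of "D - 2 * d" a] assms
    by (simp add: Nat.diff_add_assoc2 [symmetric])
  have "inj_on ?f (gor_part F d) \<longleftrightarrow> ?inj"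
  proof
    assume inj: "inj_on ?f (gor_part F d)"
    show ?inj
    proof (intro allI impI)
      fix x assume x: "homogeneous d x \<and> diff_act (?L * x) F = 0"
      hence "?f (gor_class F x) = ?f (gor_class F 0)" unfolding f by (simp add: gor_class_eq_iff)
      hence "gor_class F x = gor_class F 0"
        by (rule inj_onD [OF inj]) (use x in \<open>auto simp: gor_part_def\<close>)
      thus "diff_act x F = 0" by (simp add: gor_class_eq_iff)
    qed
  next
    assume inj: ?inj
    show "inj_on ?f (gor_part F d)"
    proof (rule inj_onI)
      fix X Y assume "X \<in> gor_part F d" "Y \<in> gor_part F d" and eq: "?f X = ?f Y"
      then obtain x y where x: "homogeneous d x" "X = gor_class F x" and y: "homogeneous d y" "Y = gor_class F y"
        by (auto simp: gor_part_def)
      have "diff_act (?L * (x - y)) F = 0"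
        using eq unfolding x y f by (simp add: gor_class_eq_iff right_diff_distrib diff_act_diff)
      hence "diff_act (x - y) F = 0" using inj homogeneous_diff x y by blast
      thus "X = Y" unfolding x y by (simp add: gor_class_eq_iff diff_act_diff)
    qed
  qed
  moreover have "?f ` gor_part F d = gor_part F (D - d) \<longleftrightarrow> ?surj"
  proof -
    have "?f ` gor_part F d = gor_class F ` (\<lambda>x. ?L * x) ` {x. homogeneous d x}"
      unfolding gor_part_def image_image f ..
    moreover have "\<dots> \<subseteq> gor_part F (D - d)"
      using hom by (auto simp: gor_part_def)
    moreover have "gor_part F (D - d) \<subseteq> gor_class F ` (\<lambda>x. ?L * x) ` {x. homogeneous d x} \<longleftrightarrow> ?surj"
      unfolding gor_part_def image_image subset_iff
      by (auto simp: image_iff gor_class_eq_iff) (metis gor_class_eq_iff)+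
    ultimately show ?thesis by auto
  qed
  ultimately show ?thesis by (simp add: bij_betw_def)
qed

text \<open>By perfectness yF vanishes once all forms b of degree \<open>d\<close> pair to zero with
  it. A basis suffices since the pairing is linear in b and depends on b only through bF.\<close>

lemma diff_act_eq_0_if_basis_pairing:
  fixes F :: "('n::finite, 'k::field_char_0) mpoly"
  assumes F: "homogeneous D F" and "d \<le> D" and B: "rep_basis F d B" and y: "homogeneous (D - d) y"
    and pairing: "\<And>j. j < length B \<Longrightarrow> Poly_Mapping.lookup (diff_act (B ! j * y) F) 0 = 0"
  shows "diff_act y F = 0"
proof (rule diff_act_eq_0_if_pairing)
  show "homogeneous d (diff_act y F)"
    using homogeneous_diff_act [OF y, of d F] F \<open>d \<le> D\<close> by simp
next
  fix b :: "('n, 'k) mpoly" assume "homogeneous d b"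
  then obtain c where "diff_act b F = diff_act (lincomb c B) F"
    using B unfolding rep_basis_def by blast
  \<comment> \<open>By commutativity b(yF) = y(bF), so \<open>b\<close> may be replaced by its
    combination of basis elements.\<close>
  hence "diff_act b (diff_act y F) = diff_act (lincomb c B) (diff_act y F)"
    by (metis diff_act_mult mult.commute)
  also have "\<dots> = (\<Sum>j<length B. mconst (c j) * diff_act (B ! j * y) F)"
    by (simp add: lincomb_def diff_act_sum diff_act_mult diff_act_mconst)
  finally show "Poly_Mapping.lookup (diff_act b (diff_act y F)) 0 = 0"
    by (simp add: lookup_sum lookup_mconst_mult pairing)
qed

text \<open>Evaluation is a ring homomorphism and hence commutes with determinants.\<close>

lemma meval_Hess:
  "meval a (Hess B F) = det (mat (length B) (length B) (\<lambda>(i, j). meval a (diff_act (B ! i * B ! j) F)))"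
  for F :: "('n::finite, 'k::comm_ring_1) mpoly"
proof -
  interpret comm_ring_hom "meval a :: ('n, 'k) mpoly \<Rightarrow> 'k" by (rule comm_ring_hom_meval)
  show ?thesis unfolding Hess_def hom_det [symmetric]
    by (rule arg_cong [where f = det]) auto
qed

text \<open>Injectivity alone forces a nonzero determinant, which in turn yields injectivity and, by
  solving a linear system, surjectivity.\<close>

lemma lefschetz_bijective_iff_Hess:
  fixes F :: "('n::finite, 'k::field_char_0) mpoly"
  assumes F: "homogeneous D F" and d: "2 * d \<le> D" and B: "rep_basis F d B"
  shows "bij_betw (\<lambda>x. (gor_class F (linform a) [^]\<^bsub>gor_alg F\<^esub> (D - 2 * d)) \<otimes>\<^bsub>gor_alg F\<^esub> x)
      (gor_part F d) (gor_part F (D - d)) \<longleftrightarrow> meval a (Hess B F) \<noteq> 0"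
proof -
  let ?e = "D - 2 * d" and ?n = "length B"
  let ?L = "linform a ^ ?e"
  define H where "H = mat ?n ?n (\<lambda>(i, j). meval a (diff_act (B ! i * B ! j) F))"
  have H: "H \<in> carrier_mat ?n ?n" by (simp add: H_def)
  have homB: "homogeneous d (B ! i)" if "i < ?n" for i
    using B that by (auto simp: rep_basis_def)
  have homlin: "homogeneous d (lincomb c B)" for c
    using B by (intro homogeneous_lincomb) (auto simp: rep_basis_def)
  have indep: "c i = 0" if "diff_act (lincomb c B) F = 0" "i < ?n" for c i
    using B that by (auto simp: rep_basis_def)
  have span: "\<exists>c. diff_act x F = diff_act (lincomb c B) F" if "homogeneous d x" for x
    using B that by (auto simp: rep_basis_def)
  have homL: "homogeneous (D - d) (?L * x)" if "homogeneous d x" for x :: "('n, 'k) mpoly"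
  proof -
    have "?e + d = D - d" using d by simp
    thus ?thesis using homogeneous_mult [OF homogeneous_linform_power that, of ?e a] by simp
  qed
  \<comment> \<open>The bridge to linear algebra: \<open>H\<close> applied to the coordinates of an
    element x lists, up to e!, the pairings of L^e x with the basis. The factor e! comes from
    Euler's identity, as the product of two forms of degree \<open>d\<close> sends \<open>F\<close>
    to degree D - 2d.\<close>
  have pairing: "Poly_Mapping.lookup (diff_act (B ! j * (?L * lincomb c B)) F) 0 =
      fact ?e * (H *\<^sub>v vec ?n c) $ j" if j: "j < ?n" for c j
  proof -
    have "homogeneous (d + d) (B ! j * lincomb c B)"
      using homB [OF j] homlin by (rule homogeneous_mult)
    hence "homogeneous ?e (diff_act (B ! j * lincomb c B) F)"
      by (rule homogeneous_diff_act) (use F d in \<open>simp add: mult_2\<close>)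
    hence *: "Poly_Mapping.lookup (diff_act ?L (diff_act (B ! j * lincomb c B) F)) 0 =
        fact ?e * meval a (diff_act (B ! j * lincomb c B) F)"
      by (rule lookup_linform_power)
    have "diff_act (B ! j * lincomb c B) F = (\<Sum>i<?n. mconst (c i) * diff_act (B ! j * B ! i) F)"
      by (simp add: lincomb_def sum_distrib_left diff_act_sum mult.left_commute [of "B ! j"] diff_act_mult [of "mconst _"] diff_act_mconst)
    hence "meval a (diff_act (B ! j * lincomb c B) F) = (H *\<^sub>v vec ?n c) $ j"
      using j by (simp add: H_def scalar_prod_def meval_sum meval_mult mult.commute atLeast0LessThan)
    with * show ?thesis by (simp add: mult.left_commute [of "B ! j"] diff_act_mult [of ?L])
  qed
  have "((\<forall>x. homogeneous d x \<and> diff_act (?L * x) F = 0 \<longrightarrow> diff_act x F = 0) \<and>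
    (\<forall>y. homogeneous (D - d) y \<longrightarrow> (\<exists>x. homogeneous d x \<and> diff_act (?L * x) F = diff_act y F)))
    \<longleftrightarrow> det H \<noteq> 0" (is "?inj \<and> ?surj \<longleftrightarrow> _")
  proof
    assume "?inj \<and> ?surj"
    hence ?inj ..
    show "det H \<noteq> 0"
    proof
      assume "det H = 0"
      \<comment> \<open>A kernel vector of \<open>H\<close> gives an element whose multiple by L^e
        pairs to zero with the whole basis, hence vanishes in A. Injectivity and independence then
        force the vector to be zero.\<close>
      then obtain v where v: "v \<in> carrier_vec ?n" "v \<noteq> 0\<^sub>v ?n" "H *\<^sub>v v = 0\<^sub>v ?n"
        using det_0_iff_vec_prod_zero_field [OF H] by blast
      have vec: "vec ?n (\<lambda>i. v $ i) = v" using v(1) by auto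
      have "diff_act (?L * lincomb (\<lambda>i. v $ i) B) F = 0"
        by (rule diff_act_eq_0_if_basis_pairing [OF F _ B homL])
          (use d v in \<open>simp_all add: homlin pairing vec\<close>)
      with \<open>?inj\<close> have "diff_act (lincomb (\<lambda>i. v $ i) B) F = 0" using homlin by blast
      hence "v $ i = 0" if "i < ?n" for i using indep that by blast
      hence "v = 0\<^sub>v ?n" using v(1) by (intro eq_vecI) auto
      with v(2) show False ..
    qed
  next
    assume det: "det H \<noteq> 0"
    have inj: "diff_act x F = 0" if x: "homogeneous d x" "diff_act (?L * x) F = 0" for x
    proof -
      obtain c where c: "diff_act x F = diff_act (lincomb c B) F" using span x(1) by blast
      have "diff_act (?L * lincomb c B) F = 0"
        using x(2) c by (simp add: diff_act_mult)
      hence "diff_act (B ! j * (?L * lincomb c B)) F = 0" for j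
        by (simp add: diff_act_mult [of "B ! j"])
      hence "(H *\<^sub>v vec ?n c) $ j = 0" if "j < ?n" for j
        using pairing [OF that, of c] by simp
      hence "H *\<^sub>v vec ?n c = 0\<^sub>v ?n" using H by (intro eq_vecI) auto
      hence "vec ?n c = 0\<^sub>v ?n" using det det_0_iff_vec_prod_zero_field [OF H] by (metis vec_carrier)
      hence "c i = 0" if "i < ?n" for i using that by (metis index_vec index_zero_vec(1))
      thus ?thesis by (simp add: c lincomb_def)
    qed
    moreover have "\<exists>x. homogeneous d x \<and> diff_act (?L * x) F = diff_act y F"
      if y: "homogeneous (D - d) y" for y
    proof -
      from det_non_zero_imp_unit [OF H det, of "()"] obtain N where
        N: "N \<in> carrier_mat ?n ?n" and HN: "H * N = 1\<^sub>m ?n"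
        unfolding Units_def ring_mat_def by auto
      \<comment> \<open>The pairings of \<open>y\<close> with the basis, with e! divided out.
        Solving \<open>H *\<^sub>v v = w\<close> makes L^e x, where x has coordinates
        \<open>v\<close>, and \<open>y\<close> pair equally with the basis, so their classes agree
        by perfectness.\<close>
      define w where "w = vec ?n (\<lambda>j. Poly_Mapping.lookup (diff_act (B ! j * y) F) 0 / fact ?e)"
      define v where "v = N *\<^sub>v w"
      have w: "w \<in> carrier_vec ?n" by (simp add: w_def)
      have v: "v \<in> carrier_vec ?n" using N w by (simp add: v_def)
      have vec: "vec ?n (\<lambda>i. v $ i) = v" using v by auto
      have Hv: "H *\<^sub>v v = w"
        unfolding v_def using assoc_mult_mat_vec [OF H N w] HN w by simp
      let ?x = "lincomb (\<lambda>i. v $ i) B"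
      have "diff_act (?L * ?x - y) F = 0"
      proof (rule diff_act_eq_0_if_basis_pairing [OF F _ B])
        show "homogeneous (D - d) (?L * ?x - y)"
          using homL homlin y by (intro homogeneous_diff) blast+
        fix j assume j: "j < ?n"
        show "Poly_Mapping.lookup (diff_act (B ! j * (?L * ?x - y)) F) 0 = 0"
          using pairing [OF j, of "\<lambda>i. v $ i"] j
          by (simp add: right_diff_distrib diff_act_diff lookup_minus vec Hv w_def)
      qed (use d in simp)
      thus ?thesis using homlin by (auto simp: diff_act_diff)
    qed
    ultimately show "?inj \<and> ?surj" by blast
  qed
  thus ?thesis unfolding lefschetz_map_bij_iff [OF d] meval_Hess H_def .
qed

text \<open>\<open>I\<close> must contain the positive degrees strictly below D/2 and may include
  the middle one, where bijectivity is automatic. This freedom lets one statement serve both the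
  full range of Hessians and the first Hessian alone.\<close>

lemma strong_Lefschetz_element_linform_iff:
  fixes F :: "('n::finite, 'k::field_char_0) mpoly"
  assumes "F \<noteq> 0" and F: "homogeneous D F"
    and B: "\<And>d. d \<in> I \<Longrightarrow> rep_basis F d (B d)"
    and I: "\<And>d. 1 \<le> d \<Longrightarrow> 2 * d < D \<Longrightarrow> d \<in> I" "I \<subseteq> {1..D div 2}"
  shows "strong_Lefschetz_element F D (gor_class F (linform a)) \<longleftrightarrow>
    meval a F \<noteq> 0 \<and> (\<forall>d\<in>I. meval a (Hess (B d) F) \<noteq> 0)"
proof -
  let ?bij = "\<lambda>d. bij_betw (\<lambda>x. (gor_class F (linform a) [^]\<^bsub>gor_alg F\<^esub> (D - 2 * d)) \<otimes>\<^bsub>gor_alg F\<^esub> x)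
      (gor_part F d) (gor_part F (D - d))"
  have "gor_class F (linform a) \<in> gor_part F 1"
    using homogeneous_linform by (auto simp: gor_part_def)
  hence "strong_Lefschetz_element F D (gor_class F (linform a)) \<longleftrightarrow> (\<forall>d\<le>D div 2. ?bij d)"
    by (simp add: strong_Lefschetz_element_def)
  also have "\<dots> \<longleftrightarrow> ?bij 0 \<and> (\<forall>d\<in>I. ?bij d)"
  proof (intro iffI conjI ballI allI impI; (elim conjE)?)
    fix d assume d: "d \<le> D div 2" and bij: "?bij 0" "\<forall>d\<in>I. ?bij d"
    show "?bij d"
    proof (cases "d = 0 \<or> d \<in> I")
      case False
      \<comment> \<open>Only the middle degree is left; there the power of L is 1 and the map is the
        identity.\<close>
      with I(1) [of d] d have "2 * d = D" by linarith
      thus ?thesis unfolding lefschetz_map_bij_iff [OF eq_refl [OF \<open>2 * d = D\<close>]] by auto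
    qed (use bij in auto)
  qed (use I(2) in auto)
  also have "?bij 0 \<longleftrightarrow> meval a F \<noteq> 0"
    using lefschetz_bijective_iff_Hess [OF F _ rep_basis_one [OF \<open>F \<noteq> 0\<close>], of a]
    by (simp add: Hess_one)
  also have "(\<forall>d\<in>I. ?bij d) \<longleftrightarrow> (\<forall>d\<in>I. meval a (Hess (B d) F) \<noteq> 0)"
  proof (rule ball_cong [OF refl])
    fix d assume "d \<in> I"
    with I(2) have "d \<le> D div 2" by auto
    hence "2 * d \<le> D" by linarith
    from lefschetz_bijective_iff_Hess [OF F this B [OF \<open>d \<in> I\<close>]]
    show "?bij d \<longleftrightarrow> meval a (Hess (B d) F) \<noteq> 0" .
  qed
  finally show ?thesis .
qed

theorem corollary3p1:
  fixes F :: "('n::finite, 'k::field_char_0) mpoly" and D :: nat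
  assumes "F \<noteq> 0" and "homogeneous D F" and "D \<ge> 1"
  shows "(\<forall>B :: nat \<Rightarrow> ('n, 'k) mpoly list.
            (\<forall>d\<in>{1..D div 2}. gor_basis F d (B d)) \<longrightarrow>
            (strong_Lefschetz_property F D \<longleftrightarrow> (\<forall>d\<in>{1..D div 2}. Hess (B d) F \<noteq> 0)))
       \<and> (2 \<le> D \<and> D < 5 \<longrightarrow>
            (\<forall>(B\<^sub>1 :: ('n, 'k) mpoly list) (a :: 'n \<Rightarrow> 'k).
               gor_basis F 1 B\<^sub>1 \<longrightarrow>
               (strong_Lefschetz_element F D (gor_class F (\<Sum>i\<in>UNIV. mconst (a i) * mvar i))
                  \<longleftrightarrow> meval a F \<noteq> 0 \<and> meval a (Hess B\<^sub>1 F) \<noteq> 0)))"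
proof (intro conjI allI impI)
  fix B :: "nat \<Rightarrow> ('n, 'k) mpoly list"
  assume "\<forall>d\<in>{1..D div 2}. gor_basis F d (B d)"
  hence B: "rep_basis F d (B d)" if "d \<in> {1..D div 2}" for d
    using that gor_basis_imp_rep_basis by blast
  have elem: "strong_Lefschetz_element F D (gor_class F (linform a)) \<longleftrightarrow>
      meval a F \<noteq> 0 \<and> (\<forall>d\<in>{1..D div 2}. meval a (Hess (B d) F) \<noteq> 0)" for a
    using assms(1,2) B by (rule strong_Lefschetz_element_linform_iff) auto
  show "strong_Lefschetz_property F D \<longleftrightarrow> (\<forall>d\<in>{1..D div 2}. Hess (B d) F \<noteq> 0)"
  proof
    assume "strong_Lefschetz_property F D"
    then obtain L where L: "strong_Lefschetz_element F D L"
      by (auto simp: strong_Lefschetz_property_def)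
    then obtain p where p: "homogeneous 1 p" "L = gor_class F p"
      by (auto simp: strong_Lefschetz_element_def gor_part_def)
    from p(1) obtain a where "p = linform a" by (rule homogeneous_1_imp_linform)
    with L p(2) have "\<forall>d\<in>{1..D div 2}. meval a (Hess (B d) F) \<noteq> 0" by (simp add: elem)
    thus "\<forall>d\<in>{1..D div 2}. Hess (B d) F \<noteq> 0" by fastforce
  next
    assume "\<forall>d\<in>{1..D div 2}. Hess (B d) F \<noteq> 0"
    \<comment> \<open>\<open>F\<close> joins the Hessians because a single point must satisfy the
      degree 0 condition as well.\<close>
    hence "\<exists>a. \<forall>p\<in>insert F ((\<lambda>d. Hess (B d) F) ` {1..D div 2}). meval a p \<noteq> 0"
      using assms(1) by (intro exists_common_nonzero_point) auto
    thus "strong_Lefschetz_property F D"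
      using elem by (auto simp: strong_Lefschetz_property_def)
  qed
next
  fix B\<^sub>1 :: "('n, 'k) mpoly list" and a :: "'n \<Rightarrow> 'k"
  assume D: "2 \<le> D \<and> D < 5" and "gor_basis F 1 B\<^sub>1"
  hence B: "rep_basis F 1 B\<^sub>1" by (simp add: gor_basis_imp_rep_basis)
  \<comment> \<open>For D < 5 no degree other than 1 is both positive and strictly below D/2, and 2
    \<le> D puts 1 into \<open>{1..D div 2}\<close>; so \<open>I\<close> can be taken as the
    singleton of 1.\<close>
  have "strong_Lefschetz_element F D (gor_class F (linform a)) \<longleftrightarrow>
      meval a F \<noteq> 0 \<and> (\<forall>d\<in>{1::nat}. meval a (Hess B\<^sub>1 F) \<noteq> 0)"
    using assms(1,2)
    by (rule strong_Lefschetz_element_linform_iff [where B = "\<lambda>_. B\<^sub>1"]) (use D B in auto)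
  thus "strong_Lefschetz_element F D (gor_class F (\<Sum>i\<in>UNIV. mconst (a i) * mvar i)) \<longleftrightarrow>
      meval a F \<noteq> 0 \<and> meval a (Hess B\<^sub>1 F) \<noteq> 0"
    by (simp add: linform_def)
qed

end
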